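(* Let $S$ be a string of length $n$ over the alphabet $[0,\sigma)$, and let $\mathcal{C}$ be its Cartesian tree. For any SLP grammar compression $\mathcal{S}$ of $S$ there is a top-tree compression $\mathcal{T}$ of $\mathcal{C}$ with size $O(|\mathcal{S}|\cdot\sigma)$ and depth $O(\mathrm{depth}(\mathcal{S})\cdot\log\sigma)$.
   Context: An SLP for $S$ is a context-free grammar generating exactly $S$ in which each rule's right-hand side is either two nonterminals or a single terminal; $|\mathcal{S}|$ is the number of rules and $\mathrm{depth}(\mathcal{S})$ is the depth of its parse tree. The Cartesian tree of an empty string is empty; otherwise, with $i$ the index of the leftmost occurrence of the minimum of $S$, it is a root whose left subtree is the Cartesian tree of $S[1,i-1]$ and whose right subtree is the Cartesian tree of $S[i+1,n]$ (an unlabeled rooted ordered binary tree). For a rooted ordered binary tree $T$, a cluster is a connected edge-subgraph of $T$ with a top boundary node (its root) and at most one bottom boundary node (a leaf of the cluster), these being the only nodes of the cluster that may have neighbours outside it. A top-tree of $T$ is a rooted ordered binary tree whose leaves are the single-edge clusters of $T$ (labeled $e_\ell$ or $e_r$ according to whether the lower endpoint is a left or right child), whose root is the cluster consisting of all of $T$, and each of whose internal nodes is the cluster obtained by merging the edge-disjoint clusters of its two children, horizontally (sharing their top boundary node) or vertically (top boundary node of the left child cluster equals bottom boundary node of the right child cluster), the union again being a cluster; internal nodes are labeled $h$ or $v$ accordingly. A top-tree compression is the DAG of a top-tree in which identical labeled subtrees are represented once; its size is the number of DAG nodes and its depth is the height of the top-tree. *)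

theory Defs
  imports Complex_Main "HOL-Library.Tree" "HOL-Library.Sublist"
begin

section \<open>Straight-line programs\<close>

datatype ('n, 't) rhs = Terminal 't | Pair 'n 'n

record ('n, 't) grammar =
  start :: 'n
  rules :: "('n \<times> ('n, 't) rhs) set"

datatype ('n, 't) parse_tree =
    PLeaf 'n 't
  | PNode 'n "('n, 't) parse_tree" "('n, 't) parse_tree"

fun parse_root :: "('n, 't) parse_tree \<Rightarrow> 'n" where
  "parse_root (PLeaf A a) = A"
| "parse_root (PNode A l r) = A"

fun yield :: "('n, 't) parse_tree \<Rightarrow> 't list" where
  "yield (PLeaf A a) = [a]"
| "yield (PNode A l r) = yield l @ yield r"

text \<open>Depth in edges: the terminal is itself a node of the parse tree, one level below the
  nonterminal of \<^const>\<open>PLeaf\<close>.\<close>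
fun parse_depth :: "('n, 't) parse_tree \<Rightarrow> nat" where
  "parse_depth (PLeaf A a) = 1"
| "parse_depth (PNode A l r) = Suc (max (parse_depth l) (parse_depth r))"

fun uses_rules :: "('n, 't) grammar \<Rightarrow> ('n, 't) parse_tree \<Rightarrow> bool" where
  "uses_rules G (PLeaf A a) \<longleftrightarrow> (A, Terminal a) \<in> rules G"
| "uses_rules G (PNode A l r) \<longleftrightarrow>
     (A, Pair (parse_root l) (parse_root r)) \<in> rules G \<and> uses_rules G l \<and> uses_rules G r"

definition is_parse_tree :: "('n, 't) grammar \<Rightarrow> ('n, 't) parse_tree \<Rightarrow> bool" where
  "is_parse_tree G P \<longleftrightarrow> uses_rules G P \<and> parse_root P = start G"

definition language :: "('n, 't) grammar \<Rightarrow> 't list set" where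
  "language G = {yield P | P. is_parse_tree G P}"

definition is_slp :: "('n, 't) grammar \<Rightarrow> 't list \<Rightarrow> bool" where
  "is_slp G S \<longleftrightarrow> finite (rules G) \<and> language G = {S}"

definition slp_size :: "('n, 't) grammar \<Rightarrow> nat" where
  "slp_size G = card (rules G)"


section \<open>Cartesian trees\<close>

definition leftmost_min :: "'a::linorder list \<Rightarrow> nat" where
  "leftmost_min S = (LEAST i. i < length S \<and> S ! i = Min (set S))"

lemma leftmost_min_less: "S \<noteq> [] \<Longrightarrow> leftmost_min S < length S"
proof -
  assume "S \<noteq> []"
  then have "Min (set S) \<in> set S" by simp
  then obtain i where "i < length S \<and> S ! i = Min (set S)"
    by (auto simp: in_set_conv_nth)
  then show ?thesis
    unfolding leftmost_min_def by (metis (mono_tags, lifting) LeastI)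
qed

text \<open>Unlabeled binary trees are trees labeled with \<^typ>\<open>unit\<close>; the constructor \<^const>\<open>Leaf\<close> is the
  empty tree and not a node. Strings are indexed from 0.\<close>
function cartesian_tree :: "'a::linorder list \<Rightarrow> unit tree" where
  "cartesian_tree S =
     (if S = [] then Leaf
      else Node (cartesian_tree (take (leftmost_min S) S)) ()
                (cartesian_tree (drop (Suc (leftmost_min S)) S)))"
  by pat_completeness auto
termination
  by (relation "measure length") (auto dest: leftmost_min_less)

declare cartesian_tree.simps [simp del]


section \<open>Clusters\<close>

datatype side = LeftChild | RightChild

text \<open>A node is addressed by the path that leads to it from the root, an edge is a pair
  (parent, child). For a nonempty set of edges, \<^const>\<open>Field\<close> is its set of nodes and
  \<^const>\<open>Domain\<close> the set of those nodes that have a child within the set.\<close>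
type_synonym node = "side list"
type_synonym edge = "node \<times> node"

fun nodes :: "'a tree \<Rightarrow> node set" where
  "nodes Leaf = {}"
| "nodes (Node l x r) =
     insert [] ((#) LeftChild ` nodes l \<union> (#) RightChild ` nodes r)"

definition edges :: "'a tree \<Rightarrow> edge set" where
  "edges T = {(p, p @ [s]) | p s. p @ [s] \<in> nodes T}"

text \<open>\<open>is_cluster T E t b\<close>: the edge set \<open>E\<close> is a cluster of \<open>T\<close> with top boundary node \<open>t\<close> and
  bottom boundary node \<open>b\<close>, if any.\<close>
definition is_cluster :: "'a tree \<Rightarrow> edge set \<Rightarrow> node \<Rightarrow> node option \<Rightarrow> bool" where
  "is_cluster T E t b \<longleftrightarrow>
     E \<noteq> {} \<and> E \<subseteq> edges T \<and>
     (\<forall>u \<in> Field E. \<forall>v \<in> Field E. (u, v) \<in> (E \<union> E\<inverse>)\<^sup>*) \<and>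
     t \<in> Field E \<and> (\<forall>v \<in> Field E. prefix t v) \<and>
     (\<forall>v. b = Some v \<longrightarrow> v \<in> Field E \<and> v \<notin> Domain E) \<and>
     (\<forall>u \<in> Field E. \<forall>w. (u, w) \<in> edges T \<union> (edges T)\<inverse> \<and> w \<notin> Field E \<longrightarrow>
        u = t \<or> b = Some u)"


section \<open>Top-trees\<close>

text \<open>\<open>EdgeLabel LeftChild\<close> and \<open>EdgeLabel RightChild\<close> are the labels $e_\ell$ and $e_r$,
  \<open>Horizontal\<close> and \<open>Vertical\<close> are $h$ and $v$.\<close>
datatype label = EdgeLabel side | Horizontal | Vertical

text \<open>\<open>represents T X E\<close>: the labeled tree \<open>X\<close> is the tree of merges of some way of building the
  cluster \<open>E\<close> from single-edge clusters of \<open>T\<close>. In a vertical merge the left child is the lower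
  cluster.\<close>
inductive represents :: "'a tree \<Rightarrow> label tree \<Rightarrow> edge set \<Rightarrow> bool" for T :: "'a tree" where
  single_edge:
    "(p, p @ [s]) \<in> edges T \<Longrightarrow> represents T (Node Leaf (EdgeLabel s) Leaf) {(p, p @ [s])}"
| horizontal:
    "represents T X A \<Longrightarrow> represents T Y B \<Longrightarrow> A \<inter> B = {} \<Longrightarrow>
     is_cluster T A t a \<Longrightarrow> is_cluster T B t b \<Longrightarrow> is_cluster T (A \<union> B) t' c \<Longrightarrow>
     represents T (Node X Horizontal Y) (A \<union> B)"
| vertical:
    "represents T X A \<Longrightarrow> represents T Y B \<Longrightarrow> A \<inter> B = {} \<Longrightarrow>
     is_cluster T A t a \<Longrightarrow> is_cluster T B u (Some t) \<Longrightarrow> is_cluster T (A \<union> B) t' c \<Longrightarrow>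
     represents T (Node X Vertical Y) (A \<union> B)"

text \<open>A tree without edges has no clusters; its top-tree is empty.\<close>
definition is_top_tree :: "'a tree \<Rightarrow> label tree \<Rightarrow> bool" where
  "is_top_tree T X \<longleftrightarrow> (if edges T = {} then X = Leaf else represents T X (edges T))"

text \<open>The nodes of the DAG that represents identical labeled subtrees once are the distinct
  nonempty subtrees.\<close>
definition dag_size :: "'a tree \<Rightarrow> nat" where
  "dag_size X = card (subtrees X - {Leaf})"

end

theory Submission
  imports Defs
begin

text \<open>Group the nodes of a spine of a Cartesian tree by value: every group, with the subtrees hanging
  off it, is a cluster, and a spine has at most \<open>\<sigma>\<close> groups. In the Cartesian tree of a concatenation
  \<open>uv\<close> the right spine for \<open>u\<close> and the left spine for \<open>v\<close> are merged by value. The part of this merged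
  path below the lower of the two roots disappears in a single subtree, so that only one spine group
  of \<open>uv\<close> is not already a group for \<open>u\<close> or \<open>v\<close>, and a balanced merge of \<open>O(\<sigma>)\<close> old clusters
  yields it. Since all nonterminals share their clusters, this costs \<open>O(\<sigma>)\<close> nodes per derived string
  and \<open>O(log \<sigma>)\<close> height per level of the parse tree.\<close>

section \<open>Clusters as placed node sets\<close>

text \<open>Addresses are relative to the top boundary node, so one \<open>N\<close> describes every
  copy of a cluster, whatever the tree and the position. Asking for a child of the root excludes
  clusters without edges.\<close>

definition shape :: "node set \<Rightarrow> node option \<Rightarrow> bool" where
  "shape N b \<longleftrightarrow> [] \<in> N \<and> (\<exists>s. [s] \<in> N) \<and> (\<forall>q s. q @ [s] \<in> N \<longrightarrow> q \<in> N) \<and>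
     (\<forall>q. b = Some q \<longrightarrow> q \<in> N \<and> (\<forall>s. q @ [s] \<notin> N))"

text \<open>The root of \<open>N\<close> may have further children in \<open>T\<close>, because it is the top boundary node.\<close>
definition placed :: "'a tree \<Rightarrow> node \<Rightarrow> node set \<Rightarrow> node option \<Rightarrow> bool" where
  "placed T p N b \<longleftrightarrow> (\<forall>u\<in>N. p @ u \<in> nodes T) \<and>
     (\<forall>u\<in>N. u \<noteq> [] \<longrightarrow> b \<noteq> Some u \<longrightarrow> (\<forall>s. p @ u @ [s] \<in> nodes T \<longrightarrow> u @ [s] \<in> N))"

definition shifted_edges :: "node \<Rightarrow> node set \<Rightarrow> edge set" where
  "shifted_edges p N = {(p @ q, p @ q @ [s]) | q s. q @ [s] \<in> N}"

text \<open>Quantifying over all trees and positions is what permits sharing: labels carry no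
  addresses, so one \<open>X\<close> serves every occurrence of \<open>N\<close>.\<close>

definition builds :: "label tree \<Rightarrow> node set \<Rightarrow> node option \<Rightarrow> bool" where
  "builds X N b \<longleftrightarrow> shape N b \<and>
     (\<forall>(T::unit tree) p. placed T p N b \<longrightarrow> represents T X (shifted_edges p N))"

section \<open>From relative node sets to clusters\<close>

lemma shape_prefix: "shape N b \<Longrightarrow> q @ v \<in> N \<Longrightarrow> q \<in> N"
proof (induction v rule: rev_induct)
  case (snoc s v)
  then show ?case unfolding shape_def by (metis append.assoc)
qed simp

lemma shape_below_bottom: "shape N (Some q) \<Longrightarrow> q @ v \<in> N \<Longrightarrow> v = []"
proof (cases v)
  case (Cons s v')
  assume *: "shape N (Some q)" "q @ v \<in> N"
  then have "(q @ [s]) @ v' \<in> N" using Cons by simp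
  then have "q @ [s] \<in> N" using shape_prefix *(1) by blast
  then show ?thesis using *(1) by (simp add: shape_def)
qed simp

lemma Field_shifted_edges:
  assumes "shape N b"
  shows "Field (shifted_edges p N) = (@) p ` N"
proof
  show "Field (shifted_edges p N) \<subseteq> (@) p ` N"
    using assms by (auto simp: Field_def shifted_edges_def shape_def)
  show "(@) p ` N \<subseteq> Field (shifted_edges p N)"
  proof
    fix v assume "v \<in> (@) p ` N"
    then obtain u where u: "u \<in> N" "v = p @ u" by auto
    show "v \<in> Field (shifted_edges p N)"
    proof (cases u rule: rev_cases)
      case Nil
      obtain s where "[s] \<in> N" using assms by (auto simp: shape_def)
      then have "(p @ [], p @ [] @ [s]) \<in> shifted_edges p N"
        unfolding shifted_edges_def by (intro CollectI exI[of _ "[]"] exI[of _ s]) simp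
      then show ?thesis using Nil u by (auto simp: Field_def)
    next
      case (snoc q s)
      then have "(p @ q, p @ q @ [s]) \<in> shifted_edges p N"
        using u by (auto simp: shifted_edges_def)
      then show ?thesis using snoc u by (auto simp: Field_def)
    qed
  qed
qed

lemma shifted_edges_connected:
  assumes "shape N b" "u \<in> N"
  shows "(p, p @ u) \<in> (shifted_edges p N)\<^sup>*"
  using assms(2)
proof (induction u rule: rev_induct)
  case (snoc s u)
  then have "u \<in> N" using shape_prefix assms(1) by blast
  moreover have "(p @ u, p @ u @ [s]) \<in> shifted_edges p N"
    using snoc.prems by (auto simp: shifted_edges_def)
  ultimately show ?case using snoc.IH by (meson rtrancl.rtrancl_into_rtrancl)
qed simp

text \<open>Any two nodes are connected through the root. A node other than the root and the bottom
  has its children in the cluster by \<open>placed\<close> and its parent by closure under prefixes,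
  so it has no neighbour outside.\<close>

lemma is_cluster_placed:
  assumes s: "shape N b" and pl: "placed T p N b"
  shows "is_cluster T (shifted_edges p N) p (map_option ((@) p) b)"
proof -
  let ?E = "shifted_edges p N"
  have F: "Field ?E = (@) p ` N" by (rule Field_shifted_edges[OF s])
  have nonempty: "?E \<noteq> {}"
    using F s by (auto simp: shape_def)
  have sub: "?E \<subseteq> edges T"
    using pl by (auto simp: shifted_edges_def edges_def placed_def) 
  have conn: "(u, v) \<in> (?E \<union> ?E\<inverse>)\<^sup>*" if u: "u \<in> Field ?E" and v: "v \<in> Field ?E" for u v
  proof -
    have reach: "(p, w) \<in> ?E\<^sup>*" if "w \<in> Field ?E" for w
      using that shifted_edges_connected[OF s] F by auto
    have "(u, p) \<in> (?E\<inverse>)\<^sup>*" using reach[OF u] by (rule rtrancl_converseI)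
    then have 1: "(u, p) \<in> (?E \<union> ?E\<inverse>)\<^sup>*" by (meson Un_upper2 in_mono rtrancl_mono)
    have 2: "(p, v) \<in> (?E \<union> ?E\<inverse>)\<^sup>*" using reach[OF v] by (meson Un_upper1 in_mono rtrancl_mono)
    from 1 2 show ?thesis by simp
  qed
  have bottom: "v \<in> Field ?E \<and> v \<notin> Domain ?E" if m: "map_option ((@) p) b = Some v" for v
  proof -
    obtain q where q: "b = Some q" "v = p @ q" using m by (cases b) auto
    then have "q \<in> N" "\<forall>s. q @ [s] \<notin> N" using s by (auto simp: shape_def)
    then show ?thesis unfolding F using q by (auto simp: shifted_edges_def)
  qed
  have boundary: "u = p \<or> map_option ((@) p) b = Some u"
    if "u \<in> Field ?E" "(u, w) \<in> edges T \<union> (edges T)\<inverse>" "w \<notin> Field ?E" for u w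
  proof (rule ccontr)
    assume c: "\<not> ?thesis"
    obtain q where q: "q \<in> N" "u = p @ q" using \<open>u \<in> Field ?E\<close> F by auto
    have q0: "q \<noteq> []" "b \<noteq> Some q" using c q by auto
    from that(2) consider s where "w = u @ [s]" "w \<in> nodes T" | s where "u = w @ [s]"
      by (auto simp: edges_def)
    then show False
    proof cases
      case 1
      then have "q @ [s] \<in> N" using pl q q0 by (auto simp: placed_def)
      then have "w \<in> Field ?E" using F 1 q by auto
      then show ?thesis using that(3) by simp
    next
      case 2
      obtain q' s' where q': "q = q' @ [s']" using q0(1) by (cases q rule: rev_cases) auto
      then have "w = p @ q'" using 2 q by simp
      moreover have "q' \<in> N" using q' q s by (auto simp: shape_def)
      ultimately show ?thesis using that(3) F by auto
    qed
  qed
  have "p \<in> Field ?E" using F s by (force simp: shape_def)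
  moreover have "\<forall>v\<in>Field ?E. prefix p v" using F by auto
  ultimately show ?thesis
    unfolding is_cluster_def using nonempty sub conn bottom boundary by blast
qed

lemma shifted_edges_Un: "shifted_edges p (M \<union> N) = shifted_edges p M \<union> shifted_edges p N"
  by (auto simp: shifted_edges_def)

section \<open>Top-trees of single edges and of merged clusters\<close>

lemma builds_edge: "builds (Node Leaf (EdgeLabel s) Leaf) {[], [s]} (Some [s])"
proof -
  have "shifted_edges p {[], [s]} = {(p, p @ [s])}" for p
    by (auto simp: shifted_edges_def)
  moreover have "(p, p @ [s]) \<in> edges T" if "placed T p {[], [s]} (Some [s])" for T :: "unit tree" and p
    using that by (auto simp: placed_def edges_def)
  moreover have "shape {[], [s]} (Some [s])" by (auto simp: shape_def)
  ultimately show ?thesis by (simp add: builds_def represents.single_edge)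
qed

text \<open>Being placed without a bottom node is the stronger demand, since the old bottom node
  must then have no children in \<open>T\<close> either. So the same top-tree still applies.\<close>

lemma builds_forget_bottom: "builds X N b \<Longrightarrow> builds X N None"
  by (auto simp: builds_def shape_def placed_def)

text \<open>As \<open>q\<close> is a leaf of \<open>M\<close>, every edge of the union that starts
  at or below \<open>q\<close> comes from \<open>N\<close>. This gives disjointness and lets both
  parts inherit their placement from the union.\<close>

lemma builds_vertical:
  assumes X: "builds X M (Some q)" and Y: "builds Y N b"
  shows "builds (Node Y Vertical X) (M \<union> (@) q ` N) (map_option ((@) q) b)"
proof -
  let ?U = "M \<union> (@) q ` N" and ?b = "map_option ((@) q) b"
  have sX: "shape M (Some q)" and sY: "shape N b" using X Y by (auto simp: builds_def)
  have qM: "q \<in> M" using sX by (simp add: shape_def)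
  have below: "v = []" if "q @ v \<in> M" for v using shape_below_bottom[OF sX that] .
  have closed: "r \<in> ?U" if "r @ [s] \<in> ?U" for r s
  proof (cases "r @ [s] \<in> M")
    case True then show ?thesis using sX by (auto simp: shape_def)
  next
    case False
    then have "r @ [s] \<in> (@) q ` N" using that by simp
    then obtain v where v: "v \<in> N" "r @ [s] = q @ v" by (elim imageE) blast
    show ?thesis
    proof (cases v rule: rev_cases)
      case Nil
      then show ?thesis using v False qM by simp
    next
      case (snoc v' s')
      then have "v' \<in> N" "r = q @ v'" using v sY by (auto simp: shape_def)
      then show ?thesis by auto
    qed
  qed
  have bot: "r \<in> ?U \<and> (\<forall>s. r @ [s] \<notin> ?U)" if m: "?b = Some r" for r
  proof -
    obtain r' where r': "b = Some r'" "r = q @ r'" using m by (cases b) auto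
    then have "r' \<in> N" "\<forall>s. r' @ [s] \<notin> N" using sY by (auto simp: shape_def)
    moreover have "r @ [s] \<notin> M" for s using below[of "r' @ [s]"] r' by auto
    ultimately show ?thesis using r' by auto
  qed
  have sh: "shape ?U ?b"
    unfolding shape_def using sX closed bot by (auto simp: shape_def)
  have E: "shifted_edges p ?U = shifted_edges p M \<union> shifted_edges (p @ q) N" for p
  proof -
    have "(p @ r, p @ r @ [s]) \<in> shifted_edges p M \<union> shifted_edges (p @ q) N"
      if "v \<in> N" "r @ [s] = q @ v" for r s v
    proof (cases v rule: rev_cases)
      case Nil
      then have "r @ [s] \<in> M" using that qM by simp
      then show ?thesis by (auto simp: shifted_edges_def)
    next
      case (snoc v' s')
      then have "r = q @ v'" "v = v' @ [s]" using that by auto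
      then show ?thesis using that(1) by (auto simp: shifted_edges_def)
    qed
    then have "shifted_edges p ?U \<subseteq> shifted_edges p M \<union> shifted_edges (p @ q) N"
      by (fastforce simp: shifted_edges_def)
    moreover have "shifted_edges p M \<union> shifted_edges (p @ q) N \<subseteq> shifted_edges p ?U"
      by (fastforce simp: shifted_edges_def)
    ultimately show ?thesis by blast
  qed
  have "represents T (Node Y Vertical X) (shifted_edges p ?U)"
    if pl: "placed T p ?U ?b" for T :: "unit tree" and p
  proof -
    have plX: "placed T p M (Some q)"
      unfolding placed_def
    proof (intro conjI ballI impI allI)
      fix u s assume u: "u \<in> M" "u \<noteq> []" "Some q \<noteq> Some u" "p @ u @ [s] \<in> nodes T"
      \<comment> \<open>The bottom node of the union, if any, lies at or below \<open>q\<close>,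
        whereas the only such node in \<open>M\<close> is \<open>q\<close> itself.\<close>
      have "?b \<noteq> Some u" using below u by auto
      then have "u @ [s] \<in> ?U" using u pl by (auto simp: placed_def)
      then show "u @ [s] \<in> M"
      proof
        assume "u @ [s] \<in> (@) q ` N"
        then obtain v where v: "u @ [s] = q @ v" by auto
        then show ?thesis
          by (cases v rule: rev_cases) (use u qM below in auto)
      qed
    qed (use pl in \<open>auto simp: placed_def\<close>)
    have plY: "placed T (p @ q) N b"
      unfolding placed_def
    proof (intro conjI ballI impI allI)
      fix u s assume u: "u \<in> N" "u \<noteq> []" "b \<noteq> Some u" "(p @ q) @ u @ [s] \<in> nodes T"
      have "?b \<noteq> Some (q @ u)" "q @ u \<in> ?U" using u by auto
      moreover have "p @ (q @ u) @ [s] \<in> nodes T" "q @ u \<noteq> []" using u by auto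
      ultimately have "(q @ u) @ [s] \<in> ?U" using pl unfolding placed_def by blast
      then show "u @ [s] \<in> N" using below[of "u @ [s]"] by auto
    qed (use pl in \<open>auto simp: placed_def\<close>)
    have "shifted_edges (p @ q) N \<inter> shifted_edges p M = {}"
      using below by (fastforce simp: shifted_edges_def)
    moreover have "represents T X (shifted_edges p M)" "represents T Y (shifted_edges (p @ q) N)"
      using X Y plX plY by (auto simp: builds_def)
    moreover have "is_cluster T (shifted_edges p M) p (Some (p @ q))"
      using is_cluster_placed[OF sX plX] by simp
    moreover note is_cluster_placed[OF sY plY]
    moreover have "is_cluster T (shifted_edges (p @ q) N \<union> shifted_edges p M) p (map_option ((@) p) ?b)"
      using is_cluster_placed[OF sh pl] by (simp add: E Un_commute)
    ultimately have "represents T (Node Y Vertical X) (shifted_edges (p @ q) N \<union> shifted_edges p M)"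
      by (intro represents.vertical)
    then show ?thesis by (simp add: E Un_commute)
  qed
  then show ?thesis using sh by (simp add: builds_def)
qed

text \<open>Serves both halves of a horizontal merge: the bottom node \<open>c\<close> of the union
  is that of the half considered, or this half has none and \<open>c\<close> is that of the other
  one.\<close>

lemma placed_branch:
  assumes "placed T p (M \<union> N) c" "shape M a" "shape N b" "M \<inter> N = {[]}"
    and "c = a \<or> a = None \<and> c = b"
  shows "placed T p M a"
  unfolding placed_def
proof (intro conjI ballI impI allI)
  fix u s assume u: "u \<in> M" "u \<noteq> []" "a \<noteq> Some u" "p @ u @ [s] \<in> nodes T"
  have "u \<notin> N" using u assms(4) by auto
  then have "c \<noteq> Some u" using assms(3,5) u by (auto simp: shape_def)
  then have "u @ [s] \<in> M \<union> N" using assms(1) u by (auto simp: placed_def)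
  then show "u @ [s] \<in> M" using \<open>u \<notin> N\<close> assms(3) by (auto simp: shape_def)
qed (use assms in \<open>auto simp: placed_def\<close>)

text \<open>Sharing only the root makes the edge sets disjoint. The second cluster has no bottom
  node because the union may keep only one.\<close>

lemma builds_horizontal:
  assumes X: "builds X M a" and Y: "builds Y N None" and disj: "M \<inter> N = {[]}"
  shows "builds (Node X Horizontal Y) (M \<union> N) a"
proof -
  have sX: "shape M a" and sY: "shape N None" using X Y by (auto simp: builds_def)
  have bot: "q @ [s] \<notin> N" if "a = Some q" for q s
  proof
    assume "q @ [s] \<in> N"
    then have "q \<in> N" using sY by (auto simp: shape_def)
    moreover have "q \<in> M" using that sX by (auto simp: shape_def)
    ultimately have "q = []" using disj by auto
    then show False using that sX by (auto simp: shape_def)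
  qed
  have sh: "shape (M \<union> N) a" using sX sY bot by (auto simp: shape_def)
  have "represents T (Node X Horizontal Y) (shifted_edges p (M \<union> N))"
    if pl: "placed T p (M \<union> N) a" for T :: "unit tree" and p
  proof -
    have plX: "placed T p M a" using placed_branch[OF pl sX sY disj] by simp
    have plY: "placed T p N None"
      using placed_branch[of T p N M a None a] pl sX sY disj by (simp add: Un_commute Int_commute)
    have "shifted_edges p M \<inter> shifted_edges p N = {}"
    proof -
      have False if "q @ [s] \<in> M" "q @ [s] \<in> N" for q s
        using that disj by auto
      then show ?thesis by (auto simp: shifted_edges_def)
    qed
    moreover have "represents T X (shifted_edges p M)" "represents T Y (shifted_edges p N)"
      using X Y plX plY by (auto simp: builds_def)
    moreover note is_cluster_placed[OF sX plX] is_cluster_placed[OF sY plY]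
    moreover have "is_cluster T (shifted_edges p M \<union> shifted_edges p N) p (map_option ((@) p) a)"
      using is_cluster_placed[OF sh pl] by (simp add: shifted_edges_Un)
    ultimately show ?thesis unfolding shifted_edges_Un by (intro represents.horizontal)
  qed
  then show ?thesis using sh by (simp add: builds_def)
qed

lemma edges_eq_shifted_edges: "edges T = shifted_edges [] (nodes T)"
  by (auto simp: edges_def shifted_edges_def)

lemma builds_is_top_tree:
  fixes T :: "unit tree"
  assumes "builds X (nodes T) None"
  shows "is_top_tree T X"
proof -
  obtain s where "[] @ [s] \<in> nodes T" using assms by (auto simp: builds_def shape_def)
  then have "([], [] @ [s]) \<in> edges T" unfolding edges_def by blast
  then have "edges T \<noteq> {}" by blast
  moreover have "placed T [] (nodes T) None" by (simp add: placed_def)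
  then have "represents T X (edges T)"
    using assms by (auto simp: builds_def edges_eq_shifted_edges)
  ultimately show ?thesis by (simp add: is_top_tree_def)
qed


section \<open>Joining Cartesian trees along their spines\<close>

text \<open>Heap order with the values still present, as joining needs them. It is strict on the
  left because the root is the leftmost minimum.\<close>

fun cartesian :: "'a::linorder tree \<Rightarrow> bool" where
  "cartesian Leaf = True"
| "cartesian (Node l a r) \<longleftrightarrow>
     cartesian l \<and> cartesian r \<and> (\<forall>x\<in>set_tree l. a < x) \<and> (\<forall>x\<in>set_tree r. a \<le> x)"

lemma leftmost_min_append:
  assumes "\<forall>x\<in>set u. a < x" "\<forall>x\<in>set v. a \<le> x"
  shows "leftmost_min (u @ a # v) = length u"
proof -
  have m: "Min (set (u @ a # v)) = a"
    using assms by (intro Min_eqI) (auto simp: less_imp_le)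
  show ?thesis
    unfolding leftmost_min_def m
  proof (rule Least_equality)
    fix i assume i: "i < length (u @ a # v) \<and> (u @ a # v) ! i = a"
    show "length u \<le> i"
    proof (rule ccontr)
      assume "\<not> length u \<le> i"
      then have "u ! i = a" "u ! i \<in> set u" using i by (auto simp: nth_append)
      then show False using assms by auto
    qed
  qed simp
qed

text \<open>Heap order forces the root to be the leftmost minimum of the inorder sequence. So
  Cartesian trees may be built by joining instead of by splitting at minima.\<close>

lemma nodes_cartesian_tree:
  "cartesian t \<Longrightarrow> nodes (cartesian_tree (inorder t)) = nodes t"
proof (induction t)
  case Leaf
  then show ?case by (simp add: cartesian_tree.simps)
next
  case (Node l a r)
  have "leftmost_min (inorder l @ a # inorder r) = length (inorder l)"
    using Node.prems by (intro leftmost_min_append) auto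
  then show ?case
    using Node by (subst cartesian_tree.simps) simp
qed

text \<open>The join of treaps with the values as priorities. The left root wins ties, in accordance
  with the leftmost minimum.\<close>

fun tree_join :: "'a::linorder tree \<Rightarrow> 'a tree \<Rightarrow> 'a tree" where
  "tree_join Leaf t = t"
| "tree_join t Leaf = t"
| "tree_join (Node l a r) (Node l' b r') =
     (if a \<le> b then Node l a (tree_join r (Node l' b r'))
      else Node (tree_join (Node l a r) l') b r')"

lemma inorder_tree_join [simp]: "inorder (tree_join s t) = inorder s @ inorder t"
  by (induction s t rule: tree_join.induct) auto

lemma set_tree_join [simp]: "set_tree (tree_join s t) = set_tree s \<union> set_tree t"
  by (induction s t rule: tree_join.induct) auto

lemma cartesian_tree_join: "cartesian s \<Longrightarrow> cartesian t \<Longrightarrow> cartesian (tree_join s t)"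
  by (induction s t rule: tree_join.induct) force+

text \<open>A step describes a node on a downward path: the side to which the path continues, the value
  of the node, and the subtree hanging off on the other side.\<close>
type_synonym 'a step = "side \<times> 'a \<times> 'a tree"

abbreviation val :: "'a step \<Rightarrow> 'a" where
  "val st \<equiv> fst (snd st)"

fun plug :: "'a step list \<Rightarrow> 'a tree \<Rightarrow> 'a tree" where
  "plug [] t = t"
| "plug ((LeftChild, a, h) # c) t = Node (plug c t) a h"
| "plug ((RightChild, a, h) # c) t = Node h a (plug c t)"

fun left_spine :: "'a tree \<Rightarrow> 'a step list" where
  "left_spine Leaf = []"
| "left_spine (Node l a r) = (LeftChild, a, r) # left_spine l"

fun right_spine :: "'a tree \<Rightarrow> 'a step list" where
  "right_spine Leaf = []"
| "right_spine (Node l a r) = (RightChild, a, l) # right_spine r"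

fun merge_steps :: "'a::linorder step list \<Rightarrow> 'a step list \<Rightarrow> 'a step list" where
  "merge_steps [] ys = ys"
| "merge_steps xs [] = xs"
| "merge_steps (x # xs) (y # ys) =
     (if val x \<le> val y then x # merge_steps xs (y # ys) else y # merge_steps (x # xs) ys)"

lemma merge_steps_Nil2 [simp]: "merge_steps xs [] = xs"
  by (cases xs) auto

lemma plug_append: "plug (c @ d) t = plug c (plug d t)"
  by (induction c t rule: plug.induct) auto

lemma plug_left_spine: "plug (left_spine t) Leaf = t"
  by (induction t) auto

lemma plug_right_spine: "plug (right_spine t) Leaf = t"
  by (induction t) auto

text \<open>Joining descends only along the right spine of \<open>s\<close> and the left spine of
  \<open>t\<close>; every subtree hanging off these spines is kept intact.\<close>

lemma tree_join_eq_plug: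
  "tree_join s t = plug (merge_steps (right_spine s) (left_spine t)) Leaf"
proof (induction s t rule: tree_join.induct)
  case (1 t)
  then show ?case by (simp add: plug_left_spine)
next
  case (2 l a r)
  then show ?case using plug_right_spine[of "Node l a r"] by simp
qed auto

lemma set_merge_steps [simp]: "set (merge_steps xs ys) = set xs \<union> set ys"
  by (induction xs ys rule: merge_steps.induct) auto

lemma sorted_merge_steps:
  "sorted (map val xs) \<Longrightarrow> sorted (map val ys) \<Longrightarrow> sorted (map val (merge_steps xs ys))"
  by (induction xs ys rule: merge_steps.induct) (auto 4 3)

text \<open>Ties favour the first list. When \<open>y\<close> is taken first, all that remains of
  the first list is larger, so no member of the group of \<open>y\<close> is overtaken.\<close>

lemma filter_merge_steps:
  "sorted (map val xs) \<Longrightarrow> sorted (map val ys) \<Longrightarrow>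
   filter (\<lambda>st. val st = x) (merge_steps xs ys) =
     filter (\<lambda>st. val st = x) xs @ filter (\<lambda>st. val st = x) ys"
proof (induction xs ys rule: merge_steps.induct)
  case (3 x' xs y ys)
  have "filter (\<lambda>st. val st = x) (x' # xs) = []" if "\<not> val x' \<le> val y" "val y = x"
    using that "3.prems" by (fastforce simp: filter_empty_conv)
  then show ?case using 3 by (auto split: if_splits)
qed auto

text \<open>Here the alphabet size enters: a sorted path falls into one possibly empty group per
  letter.\<close>

lemma sorted_eq_concat_filter:
  "sorted (map val c) \<Longrightarrow> \<forall>st\<in>set c. val st < n \<Longrightarrow>
   c = concat (map (\<lambda>x. filter (\<lambda>st. val st = x) c) [0..<n])"
proof -
  have "sorted (map val c) \<Longrightarrow>
    filter (\<lambda>st. val st < n) c = concat (map (\<lambda>x. filter (\<lambda>st. val st = x) c) [0..<n])"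
  proof (induction n)
    case (Suc n)
    have "filter (\<lambda>st. val st < Suc n) c =
        filter (\<lambda>st. val st < n) c @ filter (\<lambda>st. val st = n) c"
      using Suc.prems
    proof (induction c)
      case (Cons st c)
      have "filter (\<lambda>st. val st < n) c = []" if "val st = n"
        using that Cons.prems by (auto simp: filter_empty_conv)
      then show ?case using Cons by auto
    qed simp
    then show ?case using Suc by simp
  qed simp
  then show "sorted (map val c) \<Longrightarrow> \<forall>st\<in>set c. val st < n \<Longrightarrow> ?thesis"
    by (metis (mono_tags, lifting) filter_True)
qed

section \<open>Spines of Cartesian trees and of their joins\<close>

lemma val_left_spine: "st \<in> set (left_spine t) \<Longrightarrow> val st \<in> set_tree t"
  by (induction t) auto

lemma val_right_spine: "st \<in> set (right_spine t) \<Longrightarrow> val st \<in> set_tree t"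
  by (induction t) auto

lemma sorted_left_spine: "cartesian t \<Longrightarrow> sorted (map val (left_spine t))"
  by (induction t) (auto dest!: val_left_spine simp: less_imp_le)

lemma sorted_right_spine: "cartesian t \<Longrightarrow> sorted (map val (right_spine t))"
  by (induction t) (auto dest!: val_right_spine)

text \<open>Steps of value at most \<open>b\<close> stay above \<open>b\<close>. At the first larger
  value \<open>b\<close> takes over, and the rest of the spine merges with the left spine of
  \<open>l'\<close> into the left subtree of \<open>b\<close>.\<close>

lemma right_spine_tree_join:
  "cartesian r \<Longrightarrow> right_spine (tree_join r (Node l' b r')) =
     filter (\<lambda>st. val st \<le> b) (right_spine r) @
     (RightChild, b, plug (merge_steps (filter (\<lambda>st. b < val st) (right_spine r)) (left_spine l')) Leaf)
     # right_spine r'"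
proof (induction r)
  case Leaf
  then show ?case by (simp add: plug_left_spine)
next
  case (Node l a r)
  show ?case
  proof (cases "a \<le> b")
    case True
    then show ?thesis using Node by (simp add: leD)
  next
    case False
    then have *: "b < val st" if "st \<in> set (right_spine (Node l a r))" for st
      using that Node.prems by (auto dest!: val_right_spine)
    have "filter (\<lambda>st. b < val st) (right_spine (Node l a r)) = right_spine (Node l a r)"
      using * by (intro filter_True) blast
    moreover have "filter (\<lambda>st. val st \<le> b) (right_spine (Node l a r)) = []"
      unfolding filter_empty_conv using * by (meson leD)
    ultimately show ?thesis
      using False
      by (simp only: tree_join.simps if_False right_spine.simps tree_join_eq_plug[of _ l'] append_Nil)
  qed
qed

text \<open>The mirror image, except that steps of value \<open>a\<close> go below the root
  \<open>a\<close>, because ties favour the left tree.\<close>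

lemma left_spine_tree_join:
  "cartesian l \<Longrightarrow> left_spine (tree_join (Node l' a r') l) =
     filter (\<lambda>st. val st < a) (left_spine l) @
     (LeftChild, a, plug (merge_steps (right_spine r') (filter (\<lambda>st. a \<le> val st) (left_spine l))) Leaf)
     # left_spine l'"
proof (induction l)
  case Leaf
  then show ?case by (simp add: plug_right_spine)
next
  case (Node l b r)
  show ?case
  proof (cases "a \<le> b")
    case False
    then show ?thesis using Node by (simp add: leD)
  next
    case True
    then have *: "a \<le> val st" if "st \<in> set (left_spine (Node l b r))" for st
      using that Node.prems by (fastforce dest!: val_left_spine)
    have "filter (\<lambda>st. a \<le> val st) (left_spine (Node l b r)) = left_spine (Node l b r)"
      using * by (intro filter_True) blast
    moreover have "filter (\<lambda>st. val st < a) (left_spine (Node l b r)) = []"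
      unfolding filter_empty_conv using * by (meson leD)
    ultimately show ?thesis
      using True
      by (simp only: tree_join.simps if_True left_spine.simps tree_join_eq_plug[of r'] append_Nil)
  qed
qed


section \<open>Growing a shared set of top-trees\<close>

text \<open>The hole at the end of the path counts as a node, so the edge leaving the last step is
  included and the hole can be the bottom boundary node.\<close>

fun step_nodes :: "'a step list \<Rightarrow> node set" where
  "step_nodes [] = {[]}"
| "step_nodes ((LeftChild, a, h) # c) =
     insert [] ((#) LeftChild ` step_nodes c \<union> (#) RightChild ` nodes h)"
| "step_nodes ((RightChild, a, h) # c) =
     insert [] ((#) LeftChild ` nodes h \<union> (#) RightChild ` step_nodes c)"

lemma nodes_plug:
  "t \<noteq> Leaf \<Longrightarrow> nodes (plug c t) = step_nodes c \<union> (@) (map fst c) ` nodes t"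
  by (induction c t rule: plug.induct) (auto simp: image_Un image_image, (case_tac t; force)+)

lemma Nil_in_step_nodes [simp]: "[] \<in> step_nodes c"
  by (cases c rule: step_nodes.cases) auto

lemma step_nodes_append:
  "step_nodes (c @ d) = step_nodes c \<union> (@) (map fst c) ` step_nodes d"
  by (induction c rule: step_nodes.induct) (auto simp: image_Un image_image)

lemma bottom_in_step_nodes: "map fst c \<in> step_nodes c"
  by (induction c rule: step_nodes.induct) auto

text \<open>A set that is closed under subtrees stands for the nodes of a DAG.\<close>
definition dag :: "label tree set \<Rightarrow> bool" where
  "dag Z \<longleftrightarrow> finite Z \<and> Leaf \<in> Z \<and> (\<forall>s. Node Leaf (EdgeLabel s) Leaf \<in> Z) \<and>
     (\<forall>X\<in>Z. subtrees X \<subseteq> Z)"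

lemma dag_insert: "dag Z \<Longrightarrow> X \<in> Z \<Longrightarrow> Y \<in> Z \<Longrightarrow> dag (insert (Node X l Y) Z)"
  unfolding dag_def by auto

lemma dag_edges: "dag {Leaf, Node Leaf (EdgeLabel LeftChild) Leaf, Node Leaf (EdgeLabel RightChild) Leaf}"
  unfolding dag_def using side.exhaust by auto

definition avail :: "label tree set \<Rightarrow> nat \<Rightarrow> node set \<Rightarrow> node option \<Rightarrow> bool" where
  "avail Z H N b \<longleftrightarrow> (\<exists>X\<in>Z. height X \<le> H \<and> builds X N b)"

text \<open>A tree without edges is no cluster, so nothing is demanded of it.\<close>

definition avail_tree :: "label tree set \<Rightarrow> nat \<Rightarrow> 'a tree \<Rightarrow> bool" where
  "avail_tree Z H t \<longleftrightarrow> ((\<exists>s. [s] \<in> nodes t) \<longrightarrow> avail Z H (nodes t) None)"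

text \<open>A segment of a spine occurs in two forms: with the edge leaving its last node, and as the end
  of the spine, where this edge is missing.\<close>
definition avail_steps :: "label tree set \<Rightarrow> nat \<Rightarrow> 'a step list \<Rightarrow> bool" where
  "avail_steps Z H c \<longleftrightarrow> c = [] \<or>
     avail Z H (step_nodes c) (Some (map fst c)) \<and> avail_tree Z H (plug c Leaf)"

section \<open>Adding merged clusters to the shared set\<close>

lemma avail_mono: "avail Z H N b \<Longrightarrow> Z \<subseteq> Z' \<Longrightarrow> H \<le> H' \<Longrightarrow> avail Z' H' N b"
  unfolding avail_def by (meson order.trans subsetD)

lemma avail_tree_mono: "avail_tree Z H t \<Longrightarrow> Z \<subseteq> Z' \<Longrightarrow> H \<le> H' \<Longrightarrow> avail_tree Z' H' t"
  unfolding avail_tree_def by (meson avail_mono)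

lemma avail_steps_mono: "avail_steps Z H c \<Longrightarrow> Z \<subseteq> Z' \<Longrightarrow> H \<le> H' \<Longrightarrow> avail_steps Z' H' c"
  unfolding avail_steps_def by (meson avail_mono avail_tree_mono)

lemma avail_edge: "dag Z \<Longrightarrow> 1 \<le> H \<Longrightarrow> avail Z H {[], [s]} (Some [s])"
  unfolding avail_def dag_def
  by (rule bexI[of _ "Node Leaf (EdgeLabel s) Leaf"]) (auto simp: builds_edge)

lemma avail_forget_bottom: "avail Z H N b \<Longrightarrow> avail Z H N None"
  unfolding avail_def using builds_forget_bottom by blast

lemma avail_vertical:
  assumes "dag Z" "avail Z H M (Some q)" "avail Z H N b"
  shows "\<exists>Z'. Z \<subseteq> Z' \<and> dag Z' \<and> card Z' \<le> card Z + 1 \<and>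
    avail Z' (H + 1) (M \<union> (@) q ` N) (map_option ((@) q) b)"
proof -
  obtain X Y where X: "X \<in> Z" "height X \<le> H" "builds X M (Some q)"
    and Y: "Y \<in> Z" "height Y \<le> H" "builds Y N b"
    using assms by (auto simp: avail_def)
  let ?W = "Node Y Vertical X"
  have "card (insert ?W Z) \<le> card Z + 1"
    by (metis Suc_eq_plus1 card.infinite card_insert_le_m1 card_insert_if dag_def assms(1) le_SucI order_refl)
  moreover have "height ?W \<le> H + 1" using X Y by simp
  ultimately show ?thesis
    unfolding avail_def using dag_insert[OF assms(1) Y(1) X(1)] builds_vertical[OF X(3) Y(3)]
    by (intro exI[of _ "insert ?W Z"]) blast
qed

lemma avail_horizontal:
  assumes "dag Z" "avail Z H M a" "avail Z H N None" "M \<inter> N = {[]}"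
  shows "\<exists>Z'. Z \<subseteq> Z' \<and> dag Z' \<and> card Z' \<le> card Z + 1 \<and> avail Z' (H + 1) (M \<union> N) a"
proof -
  obtain X Y where X: "X \<in> Z" "height X \<le> H" "builds X M a"
    and Y: "Y \<in> Z" "height Y \<le> H" "builds Y N None"
    using assms by (auto simp: avail_def)
  let ?W = "Node X Horizontal Y"
  have "card (insert ?W Z) \<le> card Z + 1"
    by (metis Suc_eq_plus1 card.infinite card_insert_le_m1 card_insert_if dag_def assms(1) le_SucI order_refl)
  moreover have "height ?W \<le> H + 1" using X Y by simp
  ultimately show ?thesis
    unfolding avail_def using dag_insert[OF assms(1) X(1) Y(1)] builds_horizontal[OF X(3) Y(3) assms(4)]
    by (intro exI[of _ "insert ?W Z"]) blast
qed

lemma plug_neq_Leaf: "c \<noteq> [] \<Longrightarrow> plug c t \<noteq> Leaf"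
  by (induction c t rule: plug.induct) auto

lemma nodes_singleton: "t \<noteq> Leaf \<Longrightarrow> \<not> (\<exists>s. [s] \<in> nodes t) \<Longrightarrow> nodes t = {[]}"
proof (cases t)
  case (Node l a r)
  assume "\<not> (\<exists>s. [s] \<in> nodes t)"
  then have "l = Leaf" "r = Leaf" using Node by (cases l; cases r; force)+
  then show ?thesis using Node by simp
qed simp

lemma avail_tree_plug:
  assumes "dag Z" "c \<noteq> []" "t \<noteq> Leaf"
    and c: "avail Z H (step_nodes c) (Some (map fst c))" and t: "avail_tree Z H t"
  shows "\<exists>Z'. Z \<subseteq> Z' \<and> dag Z' \<and> card Z' \<le> card Z + 1 \<and> avail_tree Z' (H + 1) (plug c t)"
proof (cases "\<exists>s. [s] \<in> nodes t")
  case True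
  then have "avail Z H (nodes t) None" using t by (simp add: avail_tree_def)
  from avail_vertical[OF assms(1) c this] show ?thesis
    by (auto simp: avail_tree_def nodes_plug[OF assms(3)])
next
  case False
  \<comment> \<open>A single node in the hole adds no edge: the cluster of \<open>c\<close>, with
    its bottom node forgotten, is already the whole tree.\<close>
  then have "nodes (plug c t) = step_nodes c"
    using nodes_plug[OF assms(3)] nodes_singleton[OF assms(3)] bottom_in_step_nodes[of c] by auto
  then have "avail_tree Z (H + 1) (plug c t)"
    using avail_mono[OF avail_forget_bottom[OF c], of Z "H + 1"] by (simp add: avail_tree_def)
  then show ?thesis using assms(1) by auto
qed

text \<open>One new node for each form of the segment: the open form of \<open>c\<close> is merged
  with the open form and with the end form of \<open>d\<close>.\<close>

lemma avail_steps_append: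
  assumes "dag Z" "avail_steps Z H c" "avail_steps Z H d"
  shows "\<exists>Z'. Z \<subseteq> Z' \<and> dag Z' \<and> card Z' \<le> card Z + 2 \<and> avail_steps Z' (H + 1) (c @ d)"
proof (cases "c = [] \<or> d = []")
  case True
  then have "avail_steps Z (H + 1) (c @ d)"
    using assms avail_steps_mono[of Z H _ Z "H + 1"] by auto
  then show ?thesis using assms(1) by (intro exI[of _ Z]) simp
next
  case False
  then have c: "avail Z H (step_nodes c) (Some (map fst c))"
    and d: "avail Z H (step_nodes d) (Some (map fst d))" "avail_tree Z H (plug d Leaf)"
    using assms by (auto simp: avail_steps_def)
  obtain Z1 where Z1: "Z \<subseteq> Z1" "dag Z1" "card Z1 \<le> card Z + 1"
    "avail Z1 (H + 1) (step_nodes (c @ d)) (Some (map fst (c @ d)))"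
    using avail_vertical[OF assms(1) c d(1)] by (auto simp: step_nodes_append)
  have "plug d Leaf \<noteq> Leaf" using False by (simp add: plug_neq_Leaf)
  then obtain Z2 where Z2: "Z1 \<subseteq> Z2" "dag Z2" "card Z2 \<le> card Z1 + 1"
    "avail_tree Z2 (H + 1) (plug (c @ d) Leaf)"
    using avail_tree_plug[OF Z1(2) _ _ avail_mono[OF c Z1(1)] avail_tree_mono[OF d(2) Z1(1)]] False
    by (auto simp: plug_append)
  have "avail_steps Z2 (H + 1) (c @ d)"
    unfolding avail_steps_def using avail_mono[OF Z1(4) Z2(1)] Z2(4) by blast
  then show ?thesis using Z1 Z2 by (intro exI[of _ Z2]) auto
qed

text \<open>Balanced merging by halving: each halving adds one to the height, and joining
  \<open>m\<close> segments takes \<open>m - 1\<close> concatenations of two nodes each.\<close>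

lemma avail_steps_concat:
  assumes "dag Z" "\<forall>c\<in>set cs. avail_steps Z H c" "length cs \<le> 2 ^ j"
  shows "\<exists>Z'. Z \<subseteq> Z' \<and> dag Z' \<and> card Z' \<le> card Z + 2 * (length cs - 1) \<and> avail_steps Z' (H + j) (concat cs)"
  using assms
proof (induction j arbitrary: Z cs)
  case 0
  then have "cs = [] \<or> (\<exists>c. cs = [c])" by (cases cs) auto
  then show ?case
    using 0 by (intro exI[of _ Z]) (auto simp: avail_steps_def)
next
  case (Suc j)
  show ?case
  proof (cases "length cs \<le> 2 ^ j")
    case True
    from Suc.IH[OF Suc.prems(1,2) True] obtain Z' where "Z \<subseteq> Z'" "dag Z'"
      "card Z' \<le> card Z + 2 * (length cs - 1)" "avail_steps Z' (H + j) (concat cs)" by auto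
    then show ?thesis using avail_steps_mono[of Z' "H + j" _ Z' "H + Suc j"] by auto
  next
    case False
    define us vs where "us = take (2 ^ j) cs" and "vs = drop (2 ^ j) cs"
    have cs: "cs = us @ vs" and len: "length us = 2 ^ j" "length vs \<le> 2 ^ j" "vs \<noteq> []"
      using False Suc.prems(3) by (auto simp: us_def vs_def)
    obtain Z1 where Z1: "Z \<subseteq> Z1" "dag Z1" "card Z1 \<le> card Z + 2 * (length us - 1)"
      "avail_steps Z1 (H + j) (concat us)"
      using Suc.IH[of Z us] Suc.prems cs len by auto
    have "\<forall>c\<in>set vs. avail_steps Z1 H c"
      using Suc.prems(2) cs avail_steps_mono[OF _ Z1(1)] by auto
    then obtain Z2 where Z2: "Z1 \<subseteq> Z2" "dag Z2" "card Z2 \<le> card Z1 + 2 * (length vs - 1)"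
      "avail_steps Z2 (H + j) (concat vs)"
      using Suc.IH[of Z1 vs] Z1 len by auto
    obtain Z3 where Z3: "Z2 \<subseteq> Z3" "dag Z3" "card Z3 \<le> card Z2 + 2"
      "avail_steps Z3 (H + Suc j) (concat cs)"
      using avail_steps_append[OF Z2(2) avail_steps_mono[OF Z1(4) Z2(1) order_refl] Z2(4)] cs by auto
    \<comment> \<open>Both halves are nonempty, so the truncated subtractions are exact and the two
      counts plus one concatenation add up.\<close>
    have "length us \<ge> 1" "length vs \<ge> 1" using len by (simp_all add: Suc_leI)
    then have "card Z3 \<le> card Z + 2 * (length cs - 1)"
      using Z1(3) Z2(3) Z3(3) unfolding cs length_append by linarith
    then show ?thesis using Z1 Z2 Z3 by (intro exI[of _ Z3]) auto
  qed
qed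

fun opposite :: "side \<Rightarrow> side" where
  "opposite LeftChild = RightChild"
| "opposite RightChild = LeftChild"

text \<open>Attaching \<open>h\<close> below its edge gives the end form; a horizontal merge with
  the spine edge then gives the open form.\<close>

lemma avail_steps_single:
  assumes "dag Z" "1 \<le> H" "avail_tree Z H h"
  shows "\<exists>Z'. Z \<subseteq> Z' \<and> dag Z' \<and> card Z' \<le> card Z + 2 \<and> avail_steps Z' (H + 2) [(s, a, h)]"
proof (cases "h = Leaf")
  case True
  \<comment> \<open>With nothing hanging off, the open form is the bare spine edge and the end form
    is a single node.\<close>
  have "step_nodes [(s, a, h)] = {[], [s]}" "nodes (plug [(s, a, h)] Leaf) = {[]}"
    using True by (cases s; auto)+
  then have "avail_steps Z (H + 2) [(s, a, h)]"
    using avail_edge[OF assms(1), of "H + 2" s] by (simp add: avail_steps_def avail_tree_def)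
  then show ?thesis using assms(1) by (intro exI[of _ Z]) simp
next
  case False
  let ?o = "opposite s" and ?N = "insert [] ((#) (opposite s) ` nodes h)"
  have hang: "nodes (plug [(s, a, h)] Leaf) = ?N"
    by (cases s) auto
  have all: "step_nodes [(s, a, h)] = {[], [s]} \<union> ?N" and disj: "{[], [s]} \<inter> ?N = {[]}"
    by (cases s; auto)+
  \<comment> \<open>Seen from the other side, the step is a path of one edge whose hole is filled by
    \<open>h\<close>.\<close>
  have plugo: "plug [(s, a, h)] Leaf = plug [(?o, a, Leaf)] h" by (cases s) auto
  have "step_nodes [(?o, a, Leaf)] = {[], [?o]}" by (cases s) auto
  then obtain Z1 where Z1: "Z \<subseteq> Z1" "dag Z1" "card Z1 \<le> card Z + 1"
    "avail_tree Z1 (H + 1) (plug [(s, a, h)] Leaf)"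
    using avail_tree_plug[OF assms(1) _ False, of "[(?o, a, Leaf)]" H] avail_edge[OF assms(1,2)] assms(3)
    unfolding plugo by auto
  have "[?o] \<in> ?N" using False by (cases h) auto
  then have N: "avail Z1 (H + 1) ?N None" using Z1(4) unfolding avail_tree_def hang by blast
  have "avail Z1 (H + 1) {[], [s]} (Some [s])" using avail_edge[OF Z1(2)] by simp
  from avail_horizontal[OF Z1(2) this N disj] obtain Z2 where Z2: "Z1 \<subseteq> Z2" "dag Z2"
    "card Z2 \<le> card Z1 + 1" "avail Z2 (H + 2) (step_nodes [(s, a, h)]) (Some [s])"
    unfolding all by auto
  have "avail_steps Z2 (H + 2) [(s, a, h)]"
    unfolding avail_steps_def using Z2(4) avail_tree_mono[OF Z1(4) Z2(1)] by simp
  then show ?thesis using Z1 Z2 by (intro exI[of _ Z2]) auto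
qed

section \<open>Groups of equal value on the spines of a join\<close>

abbreviation level :: "'a \<Rightarrow> 'a step list \<Rightarrow> 'a step list" where
  "level x c \<equiv> filter (\<lambda>st. val st = x) c"

text \<open>The root is left out, because it belongs to both spines. Right spines may repeat the value of
  the root, left spines may not.\<close>
fun avail_spines :: "label tree set \<Rightarrow> nat \<Rightarrow> 'a tree \<Rightarrow> bool" where
  "avail_spines Z H Leaf = True"
| "avail_spines Z H (Node l a r) \<longleftrightarrow>
     (\<forall>x. avail_steps Z H (level x (left_spine l)) \<and> avail_steps Z H (level x (right_spine r)))"

lemma avail_spines_mono: "avail_spines Z H t \<Longrightarrow> Z \<subseteq> Z' \<Longrightarrow> H \<le> H' \<Longrightarrow> avail_spines Z' H' t"
  by (cases t) (auto intro: avail_steps_mono)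

lemma avail_steps_Nil [simp]: "avail_steps Z H []"
  by (simp add: avail_steps_def)

lemma avail_tree_plug_Leaf: "avail_steps Z H c \<Longrightarrow> avail_tree Z H (plug c Leaf)"
  by (auto simp: avail_steps_def avail_tree_def)

text \<open>For each value the group of \<open>xs\<close> is followed by that of \<open>ys\<close>,
  so the merged path is a concatenation of \<open>2 * n\<close> old groups. This takes at most
  \<open>2 * (2 * n - 1)\<close> nodes and \<open>j\<close> levels.\<close>

lemma avail_steps_merge:
  fixes xs ys :: "nat step list"
  assumes "dag Z" "sorted (map val xs)" "sorted (map val ys)" "\<forall>st\<in>set xs \<union> set ys. val st < n"
    and "\<forall>x. avail_steps Z H (level x xs)" "\<forall>x. avail_steps Z H (level x ys)" "2 * n \<le> 2 ^ j"
  shows "\<exists>Z'. Z \<subseteq> Z' \<and> dag Z' \<and> card Z' \<le> card Z + 4 * n \<and> avail_steps Z' (H + j) (merge_steps xs ys)"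
proof -
  let ?cs = "concat (map (\<lambda>x. [level x xs, level x ys]) [0..<n])"
  have len: "length (concat (map (\<lambda>x. [f x, g x]) zs)) = 2 * length zs"
    for f g :: "nat \<Rightarrow> nat step list" and zs
    by (induction zs) auto
  have flat: "concat (concat (map (\<lambda>x. [f x, g x]) zs)) = concat (map (\<lambda>x. f x @ g x) zs)"
    for f g :: "nat \<Rightarrow> nat step list" and zs
    by (induction zs) auto
  have "merge_steps xs ys = concat (map (\<lambda>x. level x (merge_steps xs ys)) [0..<n])"
    using sorted_eq_concat_filter[OF sorted_merge_steps[OF assms(2,3)], of n] assms(4) by simp
  also have "\<dots> = concat ?cs"
    by (simp only: filter_merge_steps[OF assms(2,3)] flat)
  finally have eq: "merge_steps xs ys = concat ?cs" .
  have "\<forall>c\<in>set ?cs. avail_steps Z H c" "length ?cs \<le> 2 ^ j"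
    using assms(5-7) len by auto
  from avail_steps_concat[OF assms(1) this] show ?thesis
    unfolding eq len by auto
qed

text \<open>Provides the one spine group that a join creates. The hanging subtree costs
  \<open>4 * n\<close> nodes and \<open>j\<close> levels, its step two nodes and two levels, and
  concatenating the three pieces four nodes and two levels.\<close>

lemma avail_steps_bridge:
  fixes xs ys :: "nat step list"
  assumes "dag Z" "sorted (map val xs)" "sorted (map val ys)" "\<forall>st\<in>set xs \<union> set ys. val st < n"
    and "\<forall>x. avail_steps Z H (level x xs)" "\<forall>x. avail_steps Z H (level x ys)" "2 * n \<le> 2 ^ j" "1 \<le> n"
    and p: "avail_steps Z H p" and q: "avail_steps Z H q"
  shows "\<exists>Z'. Z \<subseteq> Z' \<and> dag Z' \<and> card Z' \<le> card Z + (4 * n + 6) \<and>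
    avail_steps Z' (H + j + 4) (p @ (s, a, plug (merge_steps xs ys) Leaf) # q)"
proof -
  let ?J = "plug (merge_steps xs ys) Leaf"
  \<comment> \<open>As \<open>n\<close> is positive, \<open>2 * n <= 2 ^ j\<close> rules out
    \<open>j = 0\<close>, so single edges fit into the height bound.\<close>
  have j: "1 \<le> H + j" using assms(7,8) by (cases j) auto
  obtain Z1 where Z1: "Z \<subseteq> Z1" "dag Z1" "card Z1 \<le> card Z + 4 * n"
    "avail_steps Z1 (H + j) (merge_steps xs ys)"
    using avail_steps_merge[OF assms(1-7)] by auto
  obtain Z2 where Z2: "Z1 \<subseteq> Z2" "dag Z2" "card Z2 \<le> card Z1 + 2"
    "avail_steps Z2 (H + j + 2) [(s, a, ?J)]"
    using avail_steps_single[OF Z1(2) j avail_tree_plug_Leaf[OF Z1(4)]] by blast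
  have "avail_steps Z2 (H + j + 2) p" "avail_steps Z2 (H + j + 2) q"
    using avail_steps_mono[OF p, of Z2] avail_steps_mono[OF q, of Z2] Z1(1) Z2(1) by auto
  then have "\<forall>c\<in>set [p, [(s, a, ?J)], q]. avail_steps Z2 (H + j + 2) c" using Z2(4) by simp
  moreover have "length [p, [(s, a, ?J)], q] \<le> 2 ^ 2" by simp
  ultimately obtain Z3 where Z3: "Z2 \<subseteq> Z3" "dag Z3"
    "card Z3 \<le> card Z2 + 2 * (length [p, [(s, a, ?J)], q] - 1)"
    "avail_steps Z3 (H + j + 2 + 2) (concat [p, [(s, a, ?J)], q])"
    using avail_steps_concat[OF Z2(2)] by blast
  have "H + j + 2 + 2 = H + j + 4" "concat [p, [(s, a, ?J)], q] = p @ (s, a, ?J) # q" by simp_all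
  then have "avail_steps Z3 (H + j + 4) (p @ (s, a, ?J) # q)" using Z3(4) by metis
  then show ?thesis using Z1 Z2 Z3 by (intro exI[of _ Z3]) auto
qed

lemma level_filter: "level x (filter (\<lambda>st. Q (val st)) c) = (if Q x then level x c else [])"
  by (induction c) auto

text \<open>The upper root becomes the root of the join, and the spine on its outer side is
  unchanged. On the other spine, only the group with the value of the lower root is new; smaller
  values come from the tree of the upper root, larger ones from that of the lower root.\<close>

lemma avail_spines_tree_join:
  fixes t u :: "nat tree"
  assumes "dag Z" "cartesian t" "cartesian u" "t \<noteq> Leaf" "u \<noteq> Leaf"
    and bound: "\<forall>x\<in>set_tree t \<union> set_tree u. x < n" and j: "2 * n \<le> 2 ^ j"
    and t: "avail_spines Z H t" and u: "avail_spines Z H u"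
  shows "\<exists>Z'. Z \<subseteq> Z' \<and> dag Z' \<and> card Z' \<le> card Z + (4 * n + 6) \<and>
    avail_spines Z' (H + j + 4) (tree_join t u)"
proof -
  obtain l1 a r1 l2 b r2 where T: "t = Node l1 a r1" and U: "u = Node l2 b r2"
    using assms(4,5) by (meson tree.exhaust)
  have n: "1 \<le> n" using bound T by auto
  have cart: "cartesian r1" "cartesian l2" using assms(2,3) T U by auto
  have bounds: "\<forall>st\<in>set (right_spine r1) \<union> set (left_spine l2). val st < n"
    using bound T U by (auto dest!: val_left_spine val_right_spine)
  note sorted = sorted_right_spine[OF cart(1)] sorted_left_spine[OF cart(2)]
  have old: "\<forall>x. avail_steps Z H (level x (left_spine l1))" "\<forall>x. avail_steps Z H (level x (right_spine r1))"
    "\<forall>x. avail_steps Z H (level x (left_spine l2))" "\<forall>x. avail_steps Z H (level x (right_spine r2))"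
    using t u T U by auto
  show ?thesis
  proof (cases "a \<le> b")
    case True
    let ?xs = "filter (\<lambda>st. b < val st) (right_spine r1)"
    \<comment> \<open>Right spines may repeat a value, so the step of the lower root stands between
      old steps of value \<open>b\<close> from both trees.\<close>
    let ?new = "level b (right_spine r1) @
      (RightChild, b, plug (merge_steps ?xs (left_spine l2)) Leaf) # level b (right_spine r2)"
    have "\<forall>x. avail_steps Z H (level x ?xs)"
      using old(2) level_filter[of _ "\<lambda>v. b < v"] by simp
    with avail_steps_bridge[OF assms(1) sorted_filter[OF sorted(1)] sorted(2) _ _ old(3) j n,
        of "\<lambda>st. b < val st" "level b (right_spine r1)" "level b (right_spine r2)" RightChild b]
    obtain Z' where Z': "Z \<subseteq> Z'" "dag Z'" "card Z' \<le> card Z + (4 * n + 6)"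
      "avail_steps Z' (H + j + 4) ?new"
      using bounds old by auto
    have up: "avail_steps Z' (H + j + 4) c" if "avail_steps Z H c" for c :: "nat step list"
      using avail_steps_mono[OF that Z'(1)] by simp
    have le: "b \<le> val st" if "st \<in> set (right_spine r2)" for st
      using that assms(3) U by (auto dest!: val_right_spine)
    have "avail_steps Z' (H + j + 4) (level x (right_spine (tree_join r1 u)))" for x
    proof -
      consider "x < b" | "x = b" | "b < x" by linarith
      then show ?thesis
      proof cases
        case 1
        then have "level x (right_spine r2) = []" using le by (fastforce simp: filter_empty_conv)
        moreover have "level x (filter (\<lambda>st. val st \<le> b) (right_spine r1)) = level x (right_spine r1)"
          using 1 level_filter[of x "\<lambda>v. v \<le> b"] by simp
        ultimately show ?thesis
          using 1 up old(2) unfolding U right_spine_tree_join[OF cart(1)] by simp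
      next
        case 2
        then have "level x (filter (\<lambda>st. val st \<le> b) (right_spine r1)) = level x (right_spine r1)"
          using level_filter[of x "\<lambda>v. v \<le> b"] by simp
        then show ?thesis
          using 2 Z'(4) unfolding U right_spine_tree_join[OF cart(1)] by simp
      next
        case 3
        then have "level x (filter (\<lambda>st. val st \<le> b) (right_spine r1)) = []"
          using level_filter[of x "\<lambda>v. v \<le> b"] by simp
        then show ?thesis
          using 3 up old(4) unfolding U right_spine_tree_join[OF cart(1)] by simp
      qed
    qed
    moreover have "avail_steps Z' (H + j + 4) (level x (left_spine l1))" for x
      using up old(1) by simp
    moreover have "tree_join t u = Node l1 a (tree_join r1 u)" using True T U by simp
    ultimately show ?thesis using Z' by (intro exI[of _ Z']) simp
  next
    case False
    let ?ys = "filter (\<lambda>st. a \<le> val st) (left_spine l2)"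
    \<comment> \<open>On the left spine the new group is a single step: \<open>l1\<close> has only
      larger values, and steps of value \<open>a\<close> from \<open>l2\<close> moved into the
      hanging subtree.\<close>
    let ?new = "[] @ (LeftChild, a, plug (merge_steps (right_spine r1) ?ys) Leaf) # []"
    have "\<forall>x. avail_steps Z H (level x ?ys)"
      using old(3) level_filter[of _ "\<lambda>v. a \<le> v"] by simp
    with avail_steps_bridge[OF assms(1) sorted(1) sorted_filter[OF sorted(2)] _ old(2) _ j n
        avail_steps_Nil avail_steps_Nil, of "\<lambda>st. a \<le> val st" LeftChild a]
    obtain Z' where Z': "Z \<subseteq> Z'" "dag Z'" "card Z' \<le> card Z + (4 * n + 6)"
      "avail_steps Z' (H + j + 4) ?new"
      using bounds by auto
    have up: "avail_steps Z' (H + j + 4) c" if "avail_steps Z H c" for c :: "nat step list"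
      using avail_steps_mono[OF that Z'(1)] by simp
    have less: "a < val st" if "st \<in> set (left_spine l1)" for st
      using that assms(2) T by (auto dest!: val_left_spine)
    have "avail_steps Z' (H + j + 4) (level x (left_spine (tree_join t l2)))" for x
    proof -
      consider "x < a" | "x = a" | "a < x" by linarith
      then show ?thesis
      proof cases
        case 1
        then have "level x (left_spine l1) = []" using less by (fastforce simp: filter_empty_conv)
        moreover have "level x (filter (\<lambda>st. val st < a) (left_spine l2)) = level x (left_spine l2)"
          using 1 level_filter[of x "\<lambda>v. v < a"] by simp
        ultimately show ?thesis
          using 1 up old(3) unfolding T left_spine_tree_join[OF cart(2)] by simp
      next
        case 2
        then have "level x (filter (\<lambda>st. val st < a) (left_spine l2)) = []"
          using level_filter[of x "\<lambda>v. v < a"] by simp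
        moreover have "level x (left_spine l1) = []" using 2 less by (fastforce simp: filter_empty_conv)
        ultimately show ?thesis
          using 2 Z'(4) unfolding T left_spine_tree_join[OF cart(2)] by simp
      next
        case 3
        then have "level x (filter (\<lambda>st. val st < a) (left_spine l2)) = []"
          using level_filter[of x "\<lambda>v. v < a"] by simp
        then show ?thesis
          using 3 up old(1) unfolding T left_spine_tree_join[OF cart(2)] by simp
      qed
    qed
    moreover have "avail_steps Z' (H + j + 4) (level x (right_spine r2))" for x
      using up old(4) by simp
    moreover have "tree_join t u = Node (tree_join t l2) b r2" using False T U by simp
    ultimately show ?thesis using Z' by (intro exI[of _ Z']) simp
  qed
qed

text \<open>Puts the whole tree together from its groups: first the right spine below the root, then
  the root step, which carries the left subtree rebuilt from its left spine.\<close>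

lemma avail_tree_of_spines:
  fixes t :: "nat tree"
  assumes "dag Z" "cartesian t" "t \<noteq> Leaf" "\<forall>x\<in>set_tree t. x < n" "2 * n \<le> 2 ^ j" "avail_spines Z H t"
  shows "\<exists>Z'. Z \<subseteq> Z' \<and> dag Z' \<and> card Z' \<le> card Z + (8 * n + 6) \<and> avail_tree Z' (H + 2 * j + 4) t"
proof -
  obtain l a r where T: "t = Node l a r" using assms(3) by (cases t) auto
  have n: "1 \<le> n" using assms(4) T by auto
  have cart: "cartesian l" "cartesian r" using assms(2) T by auto
  have bounds: "\<forall>st\<in>set (right_spine r) \<union> set (left_spine l). val st < n"
    using assms(4) T by (auto dest!: val_left_spine val_right_spine)
  have old: "\<forall>x. avail_steps Z H (level x (left_spine l))" "\<forall>x. avail_steps Z H (level x (right_spine r))"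
    using assms(6) unfolding T avail_spines.simps by blast+
  \<comment> \<open>Merging with the empty path turns the separate groups into one segment; the left
    spine is treated likewise below.\<close>
  obtain Z1 where Z1: "Z \<subseteq> Z1" "dag Z1" "card Z1 \<le> card Z + 4 * n"
    "avail_steps Z1 (H + j) (right_spine r)"
    using avail_steps_merge[OF assms(1) sorted_right_spine[OF cart(2)], of "[]" n H j] bounds old(2) assms(5)
    by simp blast
  have "\<forall>x. avail_steps Z1 (H + j) (level x (left_spine l))"
  proof
    fix x
    show "avail_steps Z1 (H + j) (level x (left_spine l))"
      by (rule avail_steps_mono[OF spec[OF old(1)] Z1(1) le_add1])
  qed
  then obtain Z2 where Z2: "Z1 \<subseteq> Z2" "dag Z2" "card Z2 \<le> card Z1 + (4 * n + 6)"
    "avail_steps Z2 (H + j + j + 4) ((RightChild, a, l) # right_spine r)"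
    using avail_steps_bridge[OF Z1(2) _ sorted_left_spine[OF cart(1)] _ _ _ assms(5) n avail_steps_Nil Z1(4),
      of "[]" RightChild a] bounds
    by (simp add: plug_left_spine) blast
  have "plug ((RightChild, a, l) # right_spine r) Leaf = t" using T by (simp add: plug_right_spine)
  moreover have "H + j + j + 4 = H + 2 * j + 4" by simp
  ultimately have "avail_tree Z2 (H + 2 * j + 4) t"
    using avail_tree_plug_Leaf[OF Z2(4)] by metis
  then show ?thesis using Z1(1,3) Z2(1-3) by (intro exI[of _ Z2]) auto
qed


section \<open>Strings derived by a grammar\<close>

text \<open>Taking the strings by increasing length makes both factors available before their
  concatenation. The rank \<open>d\<close>, later a parse depth, pays \<open>j + 4\<close> levels
  per concatenation.\<close>

lemma avail_spines_strings:
  fixes W :: "nat list set" and d :: "nat list \<Rightarrow> nat"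
  assumes "finite W" "\<forall>w\<in>W. set w \<subseteq> {0..<n}" "2 * n \<le> 2 ^ j"
    and "\<forall>w\<in>W. (\<exists>a. w = [a]) \<or>
      (\<exists>u\<in>W. \<exists>v\<in>W. w = u @ v \<and> u \<noteq> [] \<and> v \<noteq> [] \<and> d u < d w \<and> d v < d w)"
  shows "\<exists>Z. dag Z \<and> card Z \<le> 3 + card W * (4 * n + 6) \<and>
    (\<forall>w\<in>W. \<exists>t. cartesian t \<and> inorder t = w \<and> avail_spines Z (d w * (j + 4)) t)"
  using assms
proof (induction rule: finite_ranking_induct[where f = length])
  case empty
  \<comment> \<open>The initial three elements are \<open>Leaf\<close> and the two edge
    labels.\<close>
  show ?case
    using dag_edges by (intro exI conjI, assumption) (simp_all add: card_insert_if)
next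
  case (insert w W)
  \<comment> \<open>The string \<open>w\<close> is a longest one, so a strictly shorter string
    differs from it.\<close>
  have shorter: "u \<in> W" if "u \<in> insert w W" "length u < length y" "y \<in> insert w W" for u y
    using that insert.hyps(2) by force
  have "\<forall>y\<in>W. (\<exists>a. y = [a]) \<or>
      (\<exists>u\<in>W. \<exists>v\<in>W. y = u @ v \<and> u \<noteq> [] \<and> v \<noteq> [] \<and> d u < d y \<and> d v < d y)"
  proof
    fix y assume y: "y \<in> W"
    consider "\<exists>a. y = [a]" | u v where "u \<in> insert w W" "v \<in> insert w W" "y = u @ v" "u \<noteq> []" "v \<noteq> []"
        "d u < d y" "d v < d y"
      using insert.prems(3) y by blast
    then show "(\<exists>a. y = [a]) \<or>
      (\<exists>u\<in>W. \<exists>v\<in>W. y = u @ v \<and> u \<noteq> [] \<and> v \<noteq> [] \<and> d u < d y \<and> d v < d y)"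
    proof cases
      case 2
      moreover have "length u < length y" "length v < length y" using 2(3-5) by auto
      then have "u \<in> W" "v \<in> W" using 2(1,2) y shorter by blast+
      ultimately show ?thesis by blast
    qed blast
  qed
  then obtain Z where Z: "dag Z" "card Z \<le> 3 + card W * (4 * n + 6)"
    "\<forall>w\<in>W. \<exists>t. cartesian t \<and> inorder t = w \<and> avail_spines Z (d w * (j + 4)) t"
    using insert.IH[OF _ insert.prems(2)] insert.prems(1) by blast
  show ?case
  proof (cases "w \<in> W")
    case True
    then show ?thesis using Z by (auto simp: insert_absorb)
  next
    case False
    have "\<exists>Z'. Z \<subseteq> Z' \<and> dag Z' \<and> card Z' \<le> card Z + (4 * n + 6) \<and>
      (\<exists>t. cartesian t \<and> inorder t = w \<and> avail_spines Z' (d w * (j + 4)) t)"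
    proof -
      consider a where "w = [a]" | u v where "u \<in> insert w W" "v \<in> insert w W" "w = u @ v" "u \<noteq> []" "v \<noteq> []"
          "d u < d w" "d v < d w"
        using insert.prems(3) by blast
      then show ?thesis
      proof cases
        case 1
        \<comment> \<open>A tree with a single node has empty spines on both sides of its root, so
          no new cluster is required.\<close>
        then show ?thesis
          using Z(1) by (intro exI[of _ Z] conjI exI[of _ "Node Leaf a Leaf"]) auto
      next
        case 2
        \<comment> \<open>Both factors have smaller rank than \<open>w\<close>, so
          \<open>d w\<close> is positive and the subtraction is exact.\<close>
        let ?H = "(d w - 1) * (j + 4)"
        have "length u < length w" "length v < length w" using 2(3-5) by auto
        then have "u \<in> W" "v \<in> W" using 2(1,2) by auto
        then obtain s t where st: "cartesian s" "inorder s = u" "avail_spines Z (d u * (j + 4)) s"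
          "cartesian t" "inorder t = v" "avail_spines Z (d v * (j + 4)) t"
          using Z(3) by meson
        have "d u * (j + 4) \<le> ?H" "d v * (j + 4) \<le> ?H"
          using 2(6,7) by (intro mult_right_mono; simp)+
        then have "avail_spines Z ?H s" "avail_spines Z ?H t"
          by (auto intro: avail_spines_mono[OF st(3) order_refl] avail_spines_mono[OF st(6) order_refl])
        moreover have "s \<noteq> Leaf" "t \<noteq> Leaf" using st 2 by auto
        moreover have "\<forall>x\<in>set_tree s \<union> set_tree t. x < n"
          using insert.prems(1) 2(3) st(2,5) set_inorder[of s] set_inorder[of t] by fastforce
        ultimately obtain Z' where Z': "Z \<subseteq> Z'" "dag Z'" "card Z' \<le> card Z + (4 * n + 6)"
          "avail_spines Z' (?H + j + 4) (tree_join s t)"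
          using avail_spines_tree_join[OF Z(1) st(1,4) _ _ _ assms(3)] by blast
        have "?H + j + 4 = d w * (j + 4)" using 2(6) by (cases "d w") auto
        then show ?thesis
          using Z' cartesian_tree_join[OF st(1,4)] st(2,5) 2(3)
          by (intro exI[of _ Z'] conjI exI[of _ "tree_join s t"]) auto
      qed
    qed
    then obtain Z' where Z': "Z \<subseteq> Z'" "dag Z'" "card Z' \<le> card Z + (4 * n + 6)"
      "\<exists>t. cartesian t \<and> inorder t = w \<and> avail_spines Z' (d w * (j + 4)) t" by blast
    have "card Z' \<le> 3 + card (insert w W) * (4 * n + 6)"
      using Z'(3) Z(2) False insert.hyps(1) by simp
    moreover have "\<forall>y\<in>insert w W. \<exists>t. cartesian t \<and> inorder t = y \<and> avail_spines Z' (d y * (j + 4)) t"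
    proof
      fix y assume "y \<in> insert w W"
      then consider "y = w" | "y \<in> W" by blast
      then show "\<exists>t. cartesian t \<and> inorder t = y \<and> avail_spines Z' (d y * (j + 4)) t"
        by cases (use Z'(4) Z(3) avail_spines_mono[OF _ Z'(1) order_refl] in metis)+
    qed
    ultimately show ?thesis using Z'(2) by blast
  qed
qed

section \<open>Parse trees and the strings that they derive\<close>

fun subparses :: "('n, 't) parse_tree \<Rightarrow> ('n, 't) parse_tree set" where
  "subparses (PLeaf A a) = {PLeaf A a}"
| "subparses (PNode A l r) = insert (PNode A l r) (subparses l \<union> subparses r)"

lemma self_subparses [simp]: "P \<in> subparses P"
  by (cases P) auto

lemma subparses_trans: "Q \<in> subparses P \<Longrightarrow> R \<in> subparses Q \<Longrightarrow> R \<in> subparses P"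
  by (induction P) auto

lemma finite_subparses [simp]: "finite (subparses P)"
  by (induction P) auto

lemma yield_neq_Nil [simp]: "yield P \<noteq> []"
  by (induction P) auto

lemma parse_depth_pos: "1 \<le> parse_depth P"
  by (cases P) auto

lemma uses_rules_subparse: "uses_rules G P \<Longrightarrow> Q \<in> subparses P \<Longrightarrow> uses_rules G Q"
  by (induction P) auto

lemma set_yield_subparse: "Q \<in> subparses P \<Longrightarrow> set (yield Q) \<subseteq> set (yield P)"
  by (induction P) auto

text \<open>The context-free exchange argument; it will show that a nonterminal of an SLP has only
  one yield within a parse tree.\<close>

lemma replace_subparse:
  assumes "uses_rules G P" "Q \<in> subparses P" "uses_rules G Q'" "parse_root Q' = parse_root Q"
  shows "\<exists>P' u v. uses_rules G P' \<and> parse_root P' = parse_root P \<and>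
    yield P = u @ yield Q @ v \<and> yield P' = u @ yield Q' @ v"
  using assms(1,2)
proof (induction P)
  case (PLeaf A a)
  then show ?case using assms(3,4) by (intro exI[of _ Q'] exI[of _ "[]"]) auto
next
  case (PNode A l r)
  consider "Q = PNode A l r" | "Q \<in> subparses l" | "Q \<in> subparses r" using PNode.prems by auto
  then show ?case
  proof cases
    case 1
    then show ?thesis using assms(3,4) by (intro exI[of _ Q'] exI[of _ "[]"]) auto
  next
    case 2
    then obtain P' u v where "uses_rules G P'" "parse_root P' = parse_root l"
      "yield l = u @ yield Q @ v" "yield P' = u @ yield Q' @ v"
      using PNode.IH(1) PNode.prems by auto
    then show ?thesis using PNode.prems
      by (intro exI[of _ "PNode A P' r"] exI[of _ u] exI[of _ "v @ yield r"]) auto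
  next
    case 3
    then obtain P' u v where "uses_rules G P'" "parse_root P' = parse_root r"
      "yield r = u @ yield Q @ v" "yield P' = u @ yield Q' @ v"
      using PNode.IH(2) PNode.prems by auto
    then show ?thesis using PNode.prems
      by (intro exI[of _ "PNode A l P'"] exI[of _ "yield l @ u"] exI[of _ v]) auto
  qed
qed

text \<open>If two subparses with the same root had different yields, exchanging them would derive a
  second string. So the root nonterminal determines the yield, and each such nonterminal has a
  rule.\<close>

lemma card_yields_le:
  assumes "is_slp G S" "is_parse_tree G P"
  shows "card (yield ` subparses P) \<le> slp_size G"
proof -
  have G: "uses_rules G P" "parse_root P = start G" "finite (rules G)"
    using assms by (auto simp: is_parse_tree_def is_slp_def)
  have lang: "yield R = S" if "uses_rules G R" "parse_root R = start G" for R
    using assms(1) that by (auto simp: is_slp_def language_def is_parse_tree_def)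
  have same: "yield Q = yield Q'"
    if Q: "Q \<in> subparses P" "Q' \<in> subparses P" "parse_root Q' = parse_root Q" for Q Q'
  proof -
    obtain P' u v where P': "uses_rules G P'" "parse_root P' = parse_root P"
      "yield P = u @ yield Q @ v" "yield P' = u @ yield Q' @ v"
      using replace_subparse[OF G(1) Q(1) uses_rules_subparse[OF G(1) Q(2)] Q(3)] by blast
    then have "yield P' = S" "yield P = S" using lang G by auto
    then show ?thesis using P' by auto
  qed
  define f where "f A = yield (SOME Q. Q \<in> subparses P \<and> parse_root Q = A)" for A
  have f: "f (parse_root Q) = yield Q" if "Q \<in> subparses P" for Q
  proof -
    have "(SOME R. R \<in> subparses P \<and> parse_root R = parse_root Q) \<in> subparses P \<and>
      parse_root (SOME R. R \<in> subparses P \<and> parse_root R = parse_root Q) = parse_root Q"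
      by (rule someI[of _ Q]) (simp add: that)
    then show ?thesis unfolding f_def using same that by metis
  qed
  have "parse_root Q \<in> fst ` rules G" if "Q \<in> subparses P" for Q
    using uses_rules_subparse[OF G(1) that] by (cases Q) force+
  then have "yield ` subparses P \<subseteq> f ` fst ` rules G" using f by force
  then have "card (yield ` subparses P) \<le> card (f ` fst ` rules G)"
    using G(3) by (intro card_mono) auto
  also have "\<dots> \<le> card (rules G)"
    using G(3) by (meson card_image_le finite_imageI order.trans)
  finally show ?thesis by (simp add: slp_size_def)
qed

section \<open>The bounds on size and depth\<close>

lemma top_tree_bounds:
  fixes S :: "nat list"
  assumes "set S \<subseteq> {0..<n}" "is_slp G S" "is_parse_tree G P" "2 * n \<le> 2 ^ j"
  shows "\<exists>X. is_top_tree (cartesian_tree S) X \<and>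
    dag_size X \<le> 27 * (slp_size G * n) \<and> height X \<le> 3 * (parse_depth P * (j + 4))"
proof -
  have "yield P \<in> language G" using assms(3) by (auto simp: language_def)
  then have S: "yield P = S" using assms(2) by (simp add: is_slp_def)
  let ?W = "yield ` subparses P"
  \<comment> \<open>Several subparses of different depth may derive the same string. The least depth
    depends on the string alone, and it drops at both halves of a shallowest derivation.\<close>
  define d where "d w = (LEAST k. \<exists>Q\<in>subparses P. yield Q = w \<and> parse_depth Q = k)" for w
  have d_le: "d (yield Q) \<le> parse_depth Q" if "Q \<in> subparses P" for Q
    unfolding d_def by (rule Least_le) (use that in blast)
  have d_ex: "\<exists>Q\<in>subparses P. yield Q = w \<and> parse_depth Q = d w" if "w \<in> ?W" for w
    unfolding d_def
    using that LeastI_ex[of "\<lambda>k. \<exists>Q\<in>subparses P. yield Q = w \<and> parse_depth Q = k"] by blast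
  have "\<forall>w\<in>?W. (\<exists>a. w = [a]) \<or>
      (\<exists>u\<in>?W. \<exists>v\<in>?W. w = u @ v \<and> u \<noteq> [] \<and> v \<noteq> [] \<and> d u < d w \<and> d v < d w)"
  proof
    fix w assume "w \<in> ?W"
    then obtain Q where Q: "Q \<in> subparses P" "yield Q = w" "parse_depth Q = d w" using d_ex by blast
    show "(\<exists>a. w = [a]) \<or>
      (\<exists>u\<in>?W. \<exists>v\<in>?W. w = u @ v \<and> u \<noteq> [] \<and> v \<noteq> [] \<and> d u < d w \<and> d v < d w)"
    proof (cases Q)
      case (PLeaf A a)
      then show ?thesis using Q by auto
    next
      case (PNode A l r)
      then have lr: "l \<in> subparses P" "r \<in> subparses P" using subparses_trans[OF Q(1)] by auto
      have "d (yield l) < d w" "d (yield r) < d w"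
        using d_le[OF lr(1)] d_le[OF lr(2)] Q(3) PNode by auto
      moreover have "w = yield l @ yield r" using Q PNode by auto
      moreover have "yield l \<in> ?W" "yield r \<in> ?W" using lr by simp_all
      ultimately show ?thesis using yield_neq_Nil[of l] yield_neq_Nil[of r] by blast
    qed
  qed
  moreover have "\<forall>w\<in>?W. set w \<subseteq> {0..<n}"
    using set_yield_subparse[of _ P] assms(1) S by blast
  ultimately obtain Z where Z: "dag Z" "card Z \<le> 3 + card ?W * (4 * n + 6)"
    "\<forall>w\<in>?W. \<exists>t. cartesian t \<and> inorder t = w \<and> avail_spines Z (d w * (j + 4)) t"
    using avail_spines_strings[of ?W n j d] assms(4) finite_imageI[OF finite_subparses] by blast
  have "S \<in> ?W" using S by force
  then obtain t where t: "cartesian t" "inorder t = S" "avail_spines Z (d S * (j + 4)) t" using Z(3) by blast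
  have dS: "d S \<le> parse_depth P" using d_le[of P] S by simp
  have ne: "S \<noteq> []" using S yield_neq_Nil by blast
  then have t0: "t \<noteq> Leaf" using t by auto
  have n: "1 \<le> n" using ne assms(1) by (cases S) auto
  have "\<forall>x\<in>set_tree t. x < n" using assms(1) t(2) set_inorder[of t] by auto
  from avail_tree_of_spines[OF Z(1) t(1) t0 this assms(4) t(3)]
  obtain Z' where Z': "Z \<subseteq> Z'" "dag Z'" "card Z' \<le> card Z + (8 * n + 6)"
    "avail_tree Z' (d S * (j + 4) + 2 * j + 4) t" by blast
  have nodes: "nodes (cartesian_tree S) = nodes t" using nodes_cartesian_tree[OF t(1)] t(2) by simp
  show ?thesis
  proof (cases "\<exists>s. [s] \<in> nodes t")
    case False
    \<comment> \<open>A tree with one node has no edges, and its top-tree is empty by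
      convention.\<close>
    then have "edges (cartesian_tree S) = {}"
      using nodes_singleton[OF t0] by (simp add: edges_def nodes)
    then show ?thesis by (intro exI[of _ Leaf]) (simp add: is_top_tree_def dag_size_def)
  next
    case True
    then obtain X where X: "X \<in> Z'" "height X \<le> d S * (j + 4) + 2 * j + 4" "builds X (nodes t) None"
      using Z'(4) unfolding avail_tree_def avail_def by blast
    have "dag_size X \<le> card Z'"
      unfolding dag_size_def using X(1) Z'(2) by (intro card_mono) (auto simp: dag_def)
    also have "\<dots> \<le> 9 + 8 * n + card ?W * (4 * n + 6)" using Z'(3) Z(2) by linarith
    \<comment> \<open>With both factors at least 1, each summand is at most its coefficient times
      the product, and 9 + 8 + 4 + 6 = 27.\<close>
    also have "\<dots> \<le> 27 * (card ?W * n)"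
    proof -
      have "card ?W \<noteq> 0" using \<open>S \<in> ?W\<close> by auto
      then obtain k where k: "card ?W = Suc k" using not0_implies_Suc by blast
      obtain m where m: "n = Suc m" using n by (cases n) auto
      show ?thesis unfolding k m by (simp add: algebra_simps)
    qed
    also have "\<dots> \<le> 27 * (slp_size G * n)" using card_yields_le[OF assms(2,3)] by simp
    finally have size: "dag_size X \<le> 27 * (slp_size G * n)" .
    have "d S * (j + 4) \<le> parse_depth P * (j + 4)" using dS by (rule mult_right_mono) simp
    \<comment> \<open>The extra \<open>2 * j + 4\<close> levels of the final assembly are at most
      twice this bound, whence the factor 3.\<close>
    moreover have "j + 4 \<le> parse_depth P * (j + 4)"
      using parse_depth_pos[of P] by (cases "parse_depth P") auto
    ultimately have "height X \<le> 3 * (parse_depth P * (j + 4))" using X(2) by linarith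
    moreover have "is_top_tree (cartesian_tree S) X"
      by (rule builds_is_top_tree) (simp only: nodes X(3))
    ultimately show ?thesis using size by blast
  qed
qed

text \<open>The maximum with 1 covers \<open>\<sigma> = 1\<close>, where the logarithm vanishes
  while the top-tree may have positive height.\<close>

theorem theorem3:
  shows "\<exists>C > 0. \<exists>D > 0. \<forall>(\<sigma>::nat) (S::nat list) (G::(nat, nat) grammar) (P::(nat, nat) parse_tree).
    set S \<subseteq> {0..<\<sigma>} \<longrightarrow> is_slp G S \<longrightarrow> is_parse_tree G P \<longrightarrow>
    (\<exists>X. is_top_tree (cartesian_tree S) X \<and>
         real (dag_size X) \<le> C * (real (slp_size G) * real \<sigma>) \<and>
         real (height X) \<le> D * (real (parse_depth P) * max 1 (log 2 (real \<sigma>))))"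
proof (rule exI[of _ 27], intro conjI exI[of _ 21] allI impI)
  fix \<sigma> :: nat and S :: "nat list" and G :: "(nat, nat) grammar" and P :: "(nat, nat) parse_tree"
  assume S: "set S \<subseteq> {0..<\<sigma>}" and G: "is_slp G S" and P: "is_parse_tree G P"
  \<comment> \<open>The number of halvings needed to concatenate the \<open>2 * \<sigma>\<close>
    groups of two spines.\<close>
  define j where "j = nat \<lceil>log 2 (real (2 * \<sigma>))\<rceil>"
  have "yield P = S" using G P by (auto simp: is_slp_def language_def)
  then have "S \<noteq> []" by auto
  then have pos: "\<sigma> > 0" using S by (cases S) auto
  have "real (2 * \<sigma>) = 2 powr log 2 (real (2 * \<sigma>))" using pos by simp
  also have "\<dots> \<le> 2 powr real j"
    unfolding j_def by (intro powr_mono) (auto simp: real_nat_ceiling_ge)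
  finally have "real (2 * \<sigma>) \<le> real (2 ^ j)" by (simp add: powr_realpow)
  then have "2 * \<sigma> \<le> 2 ^ j" by (simp only: of_nat_le_iff)
  from top_tree_bounds[OF S G P this] obtain X where X: "is_top_tree (cartesian_tree S) X"
    "dag_size X \<le> 27 * (slp_size G * \<sigma>)" "height X \<le> 3 * (parse_depth P * (j + 4))" by blast
  have "log 2 (real (2 * \<sigma>)) = 1 + log 2 (real \<sigma>)" using pos by (simp add: log_mult)
  moreover have "0 \<le> log 2 (real \<sigma>)" using pos by simp
  ultimately have "real j \<le> 2 + log 2 (real \<sigma>)" unfolding j_def by linarith
  \<comment> \<open>Doubling and rounding up cost at most 2 beyond the logarithm; with the 4 this
    makes 6 plus the logarithm. Hence 7, and 21 = 3 * 7 overall.\<close>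
  then have j: "real (j + 4) \<le> 7 * max 1 (log 2 (real \<sigma>))" by linarith
  have "real (dag_size X) \<le> real (27 * (slp_size G * \<sigma>))" using X(2) by (simp only: of_nat_le_iff)
  moreover have "real (height X) \<le> 21 * (real (parse_depth P) * max 1 (log 2 (real \<sigma>)))"
  proof -
    have "real (height X) \<le> real (3 * (parse_depth P * (j + 4)))" using X(3) by (simp only: of_nat_le_iff)
    also have "\<dots> = 3 * (real (parse_depth P) * real (j + 4))" by simp
    also have "\<dots> \<le> 3 * (real (parse_depth P) * (7 * max 1 (log 2 (real \<sigma>))))"
      using j by (intro mult_left_mono) auto
    finally show ?thesis by simp
  qed
  ultimately show "\<exists>X. is_top_tree (cartesian_tree S) X \<and>
         real (dag_size X) \<le> 27 * (real (slp_size G) * real \<sigma>) \<and>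
         real (height X) \<le> 21 * (real (parse_depth P) * max 1 (log 2 (real \<sigma>)))"
    using X(1) by (intro exI[of _ X]) simp
qed auto

end
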